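(* Let $G,H$ be connected graphs and let $f:V(G)\to V(H)$ be any mapping. Let $g\in V(G)$ and $\beta\in\mathrm{Aut}(H)$. Define $\Phi(g,\beta):V(G\otimes_f H)\to V(G\otimes_f H)$ by $\Phi(g,\beta)(g_1,h_1)=(g_1,h_1)$ if $g_1\neq g$, and $\Phi(g,\beta)(g_1,h_1)=(g_1,\beta(h_1))$ if $g_1=g$. Then $\Phi(g,\beta)$ is an automorphism of $G\otimes_f H$ if and only if $\beta$ is in the stabilizer of $f(N(g))$, i.e. $\beta$ fixes every element of $f(N(g))$. Moreover, in this case $\Phi(g,\beta)$ respects the fundamental edge partition.
   Context: Graphs are undirected and simple. For graphs $G,H$ and a function $f:V(G)\to V(H)$, the Sierpiński product $G\otimes_f H$ is the graph with vertex set $V(G)\times V(H)$ and the following edges: the inner edges $\{(g,h),(g,h')\}$ for every $g\in V(G)$ and every $\{h,h'\}\in E(H)$; and the connecting edges $\{(g,f(g')),(g',f(g))\}$ for every $\{g,g'\}\in E(G)$. This partition of the edge set into inner and connecting edges is the fundamental edge partition. An automorphism of $G\otimes_f H$ respects the fundamental edge partition if it takes inner edges to inner edges and connecting edges to connecting edges. $N(g)$ denotes the set of neighbours of $g$ in $G$. Stabilizers of sets are pointwise. *)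

theory Defs
  imports Main "HOL-Library.FuncSet"
begin

record 'a graph =
  verts :: "'a set"
  edges :: "'a set set"

definition simple_graph :: "'a graph \<Rightarrow> bool" where
  "simple_graph G \<longleftrightarrow> (\<forall>e\<in>edges G. e \<subseteq> verts G \<and> card e = 2)"

definition connected_graph :: "'a graph \<Rightarrow> bool" where
  "connected_graph G \<longleftrightarrow>
     (\<forall>u\<in>verts G. \<forall>v\<in>verts G. (u, v) \<in> {(x, y). {x, y} \<in> edges G}\<^sup>*)"

definition neighbours :: "'a graph \<Rightarrow> 'a \<Rightarrow> 'a set" where
  "neighbours G g = {g' \<in> verts G. {g, g'} \<in> edges G}"

text \<open>An automorphism is a total HOL function of which only the restriction to the vertex set
  matters; its values outside the vertex set are unconstrained.\<close>

definition Aut :: "'a graph \<Rightarrow> ('a \<Rightarrow> 'a) set" where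
  "Aut G = {\<phi>. bij_betw \<phi> (verts G) (verts G) \<and>
     (\<forall>u\<in>verts G. \<forall>v\<in>verts G. {u, v} \<in> edges G \<longleftrightarrow> {\<phi> u, \<phi> v} \<in> edges G)}"

definition pointwise_stabilizer :: "'a graph \<Rightarrow> 'a set \<Rightarrow> ('a \<Rightarrow> 'a) set" where
  "pointwise_stabilizer G X = {\<phi> \<in> Aut G. \<forall>x\<in>X. \<phi> x = x}"

definition inner_edges :: "'a graph \<Rightarrow> 'b graph \<Rightarrow> ('a \<times> 'b) set set" where
  "inner_edges G H = {{(g, h), (g, h')} | g h h'. g \<in> verts G \<and> {h, h'} \<in> edges H}"

definition connecting_edges :: "'a graph \<Rightarrow> ('a \<Rightarrow> 'b) \<Rightarrow> ('a \<times> 'b) set set" where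
  "connecting_edges G f = {{(g, f g'), (g', f g)} | g g'. {g, g'} \<in> edges G}"

definition sierpinski_product :: "'a graph \<Rightarrow> ('a \<Rightarrow> 'b) \<Rightarrow> 'b graph \<Rightarrow> ('a \<times> 'b) graph" where
  "sierpinski_product G f H =
     \<lparr>verts = verts G \<times> verts H, edges = inner_edges G H \<union> connecting_edges G f\<rparr>"

definition respects_fundamental_edge_partition ::
  "'a graph \<Rightarrow> ('a \<Rightarrow> 'b) \<Rightarrow> 'b graph \<Rightarrow> ('a \<times> 'b \<Rightarrow> 'a \<times> 'b) \<Rightarrow> bool" where
  "respects_fundamental_edge_partition G f H \<phi> \<longleftrightarrow>
     (\<forall>e\<in>inner_edges G H. \<phi> ` e \<in> inner_edges G H) \<and>
     (\<forall>e\<in>connecting_edges G f. \<phi> ` e \<in> connecting_edges G f)"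

definition Phi :: "'a \<Rightarrow> ('b \<Rightarrow> 'b) \<Rightarrow> 'a \<times> 'b \<Rightarrow> 'a \<times> 'b" where
  "Phi g \<beta> = (\<lambda>(g1, h1). if g1 = g then (g1, \<beta> h1) else (g1, h1))"

end

theory Submission
  imports Defs
begin

text \<open>\<open>Phi g \<beta>\<close> never changes a first coordinate; it only applies
  \<open>\<beta>\<close> inside the fibre over \<open>g\<close>. Inner edges join vertices with
  equal first coordinates and connecting edges, as G has no loops, join vertices with different
  ones, so the two classes cannot be mixed. Inner edges are harmless because \<open>\<beta>\<close>
  is an automorphism of H (\<open>Phi_inner_edge_iff\<close>). A connecting edge meets the fibre
  over \<open>g\<close> only in a vertex \<open>(g, f g')\<close> with \<open>g'\<close> a neighbour
  of \<open>g\<close>; its other end stays put and determines that vertex, so the image is an edge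
  exactly when \<open>\<beta>\<close> fixes \<open>f g'\<close>
  (\<open>Phi_connecting_edge_iff\<close> for sufficiency).\<close>

lemma simple_graph_edgeD:
  assumes "simple_graph G" "{u, v} \<in> edges G"
  shows "u \<in> verts G" "v \<in> verts G" "u \<noteq> v"
  using assms unfolding simple_graph_def by force+

lemma inner_edge_iff:
  "{(a, x), (b, y)} \<in> inner_edges G H \<longleftrightarrow> a = b \<and> a \<in> verts G \<and> {x, y} \<in> edges H"
  unfolding inner_edges_def by (auto simp: doubleton_eq_iff insert_commute)

lemma connecting_edge_iff:
  "{(a, x), (b, y)} \<in> connecting_edges G f \<longleftrightarrow> {a, b} \<in> edges G \<and> x = f b \<and> y = f a"
  unfolding connecting_edges_def by (auto simp: doubleton_eq_iff insert_commute)

lemma sierpinski_product_simps [simp]: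
  "verts (sierpinski_product G f H) = verts G \<times> verts H"
  "edges (sierpinski_product G f H) = inner_edges G H \<union> connecting_edges G f"
  by (simp_all add: sierpinski_product_def)

lemma Phi_apply: "Phi g \<beta> (a, x) = (a, if a = g then \<beta> x else x)"
  by (simp add: Phi_def)

lemma bij_betw_Phi:
  assumes "bij_betw \<beta> B B"
  shows "bij_betw (Phi g \<beta>) (A \<times> B) (A \<times> B)"
proof (rule bij_betw_imageI)
  have inj: "inj_on \<beta> B" and img: "\<beta> ` B = B"
    using assms by (auto simp: bij_betw_def)
  show "inj_on (Phi g \<beta>) (A \<times> B)"
    using inj by (auto simp: inj_on_def Phi_apply split: if_splits)
  show "Phi g \<beta> ` (A \<times> B) = A \<times> B"
  proof
    show "Phi g \<beta> ` (A \<times> B) \<subseteq> A \<times> B"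
      using bij_betwE[OF assms] by (auto simp: Phi_apply)
    show "A \<times> B \<subseteq> Phi g \<beta> ` (A \<times> B)"
    proof clarify
      fix a y assume "a \<in> A" "y \<in> B"
      moreover obtain x where "x \<in> B" "y = \<beta> x" using \<open>y \<in> B\<close> img by blast
      \<comment> \<open>The preimage differs from \<open>(a, y)\<close> only in the fibre over
        \<open>g\<close>, where \<open>\<beta>\<close> has to be undone.\<close>
      ultimately have "(a, y) = Phi g \<beta> (a, if a = g then x else y)"
        "(a, if a = g then x else y) \<in> A \<times> B"
        by (auto simp: Phi_apply)
      then show "(a, y) \<in> Phi g \<beta> ` (A \<times> B)" by (rule image_eqI)
    qed
  qed
qed

text \<open>Both ends of an inner edge lie in one fibre, so \<open>\<beta>\<close> acts on both or
  on neither. The ends must be vertices because \<open>Aut\<close> says nothing about values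
  elsewhere.\<close>

lemma Phi_inner_edge_iff:
  assumes "\<beta> \<in> Aut H" "x \<in> verts H" "y \<in> verts H"
  shows "{Phi g \<beta> (a, x), Phi g \<beta> (b, y)} \<in> inner_edges G H \<longleftrightarrow>
    {(a, x), (b, y)} \<in> inner_edges G H"
  using assms by (auto simp: Phi_apply inner_edge_iff Aut_def)

text \<open>At most one end lies over \<open>g\<close>, and there the condition on its second
  coordinate is equality with a value \<open>f c\<close>, \<open>c\<close> a neighbour of
  \<open>g\<close>, which applying \<open>\<beta>\<close> does not affect.\<close>

lemma Phi_connecting_edge_iff:
  assumes G: "simple_graph G" and f: "f \<in> verts G \<rightarrow> verts H"
    and \<beta>: "\<beta> \<in> pointwise_stabilizer H (f ` neighbours G g)"
    and x: "x \<in> verts H" and y: "y \<in> verts H"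
  shows "{Phi g \<beta> (a, x), Phi g \<beta> (b, y)} \<in> connecting_edges G f \<longleftrightarrow>
    {(a, x), (b, y)} \<in> connecting_edges G f"
proof (cases "{a, b} \<in> edges G")
  case True
  note ab = simple_graph_edgeD[OF G True]
  have inj: "inj_on \<beta> (verts H)"
    using \<beta> by (simp add: pointwise_stabilizer_def Aut_def bij_betw_def)
  \<comment> \<open>Fixing \<open>f c\<close> gives one direction; by injectivity no other vertex is
    sent to \<open>f c\<close>, which gives the converse.\<close>
  have eq: "\<beta> z = f c \<longleftrightarrow> z = f c" if "{g, c} \<in> edges G" "z \<in> verts H" for c z
  proof -
    have c: "c \<in> neighbours G g"
      using that simple_graph_edgeD[OF G] by (simp add: neighbours_def)
    then have "\<beta> (f c) = f c" using \<beta> by (simp add: pointwise_stabilizer_def)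
    moreover have "f c \<in> verts H" using c f by (auto simp: neighbours_def)
    ultimately show ?thesis using inj that(2) by (metis inj_onD)
  qed
  \<comment> \<open>The reversed form lets \<open>eq\<close> apply when \<open>b\<close>, rather
    than \<open>a\<close>, equals \<open>g\<close>.\<close>
  from True have "{b, a} \<in> edges G" by (simp add: insert_commute)
  with True ab eq x y show ?thesis
    by (auto simp: Phi_apply connecting_edge_iff)
qed (simp add: Phi_apply connecting_edge_iff)

theorem proposition3p14:
  fixes G :: "'a graph" and H :: "'b graph" and f :: "'a \<Rightarrow> 'b"
    and g :: 'a and \<beta> :: "'b \<Rightarrow> 'b"
  assumes "simple_graph G" and "connected_graph G"
    and "simple_graph H" and "connected_graph H"
    and "f \<in> verts G \<rightarrow> verts H"
    and "g \<in> verts G"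
    and "\<beta> \<in> Aut H"
  shows "(Phi g \<beta> \<in> Aut (sierpinski_product G f H) \<longleftrightarrow>
            \<beta> \<in> pointwise_stabilizer H (f ` neighbours G g)) \<and>
         (\<beta> \<in> pointwise_stabilizer H (f ` neighbours G g) \<longrightarrow>
            respects_fundamental_edge_partition G f H (Phi g \<beta>))"
proof (intro conjI iffI impI)
  assume aut: "Phi g \<beta> \<in> Aut (sierpinski_product G f H)"
  have "\<beta> (f g') = f g'" if "g' \<in> neighbours G g" for g'
  proof -
    have e: "{g, g'} \<in> edges G" using that by (simp add: neighbours_def)
    note v = simple_graph_edgeD[OF assms(1) e]
    have "(g, f g') \<in> verts (sierpinski_product G f H)"
      "(g', f g) \<in> verts (sierpinski_product G f H)"
      using v assms(5) by auto
    moreover have "{(g, f g'), (g', f g)} \<in> edges (sierpinski_product G f H)"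
      using e by (simp add: connecting_edge_iff)
    ultimately have "{Phi g \<beta> (g, f g'), Phi g \<beta> (g', f g)} \<in> edges (sierpinski_product G f H)"
      using aut unfolding Aut_def by blast
    \<comment> \<open>Since \<open>g\<close> and \<open>g'\<close> differ, the image edge is
      connecting, and its unmoved end \<open>(g', f g)\<close> forces the other to be
      \<open>(g, f g')\<close>.\<close>
    then show ?thesis
      using v by (simp add: Phi_apply inner_edge_iff connecting_edge_iff)
  qed
  then show "\<beta> \<in> pointwise_stabilizer H (f ` neighbours G g)"
    using assms(7) by (auto simp: pointwise_stabilizer_def)
next
  assume \<beta>: "\<beta> \<in> pointwise_stabilizer H (f ` neighbours G g)"
  have "bij_betw \<beta> (verts H) (verts H)" using assms(7) by (simp add: Aut_def)
  \<comment> \<open>Each edge class is preserved and reflected separately, hence so is their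
    union.\<close>
  then show "Phi g \<beta> \<in> Aut (sierpinski_product G f H)"
    by (auto simp: Aut_def bij_betw_Phi Phi_inner_edge_iff[OF assms(7)]
        Phi_connecting_edge_iff[OF assms(1,5) \<beta>])
next
  assume \<beta>: "\<beta> \<in> pointwise_stabilizer H (f ` neighbours G g)"
  show "respects_fundamental_edge_partition G f H (Phi g \<beta>)"
    unfolding respects_fundamental_edge_partition_def
  proof (intro conjI ballI)
    fix e assume e: "e \<in> inner_edges G H"
    then obtain a x y where axy: "e = {(a, x), (a, y)}" "{x, y} \<in> edges H"
      unfolding inner_edges_def by blast
    note xy = simple_graph_edgeD(1,2)[OF assms(3) axy(2)]
    from e axy(1) show "Phi g \<beta> ` e \<in> inner_edges G H"
      by (simp add: Phi_inner_edge_iff[OF assms(7) xy])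
  next
    fix e assume e: "e \<in> connecting_edges G f"
    then obtain a b where ab: "e = {(a, f b), (b, f a)}" "{a, b} \<in> edges G"
      unfolding connecting_edges_def by blast
    have "f a \<in> verts H" "f b \<in> verts H"
      using assms(5) simple_graph_edgeD[OF assms(1) ab(2)] by auto
    with e ab(1) show "Phi g \<beta> ` e \<in> connecting_edges G f"
      using Phi_connecting_edge_iff[OF assms(1,5) \<beta>] by simp
  qed
qed

end
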